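(* Let $G=(V,E)$ be an index coding problem with side information subsets $A_1,\dots,A_n$ satisfying $$A_j\subseteq\{j-1,j+1\}\quad\text{for all } j\in[1:n],$$ where indices are taken cyclically modulo $n$. Then an edge $e\in E$ is critical if and only if it belongs to a unicycle.
   Context: Index coding problem: let $n\ge 1$ and $[1:n]=\{1,\dots,n\}$. An index coding problem is specified by side information subsets $A_1,\dots,A_n$ with $A_j\subseteq[1:n]\setminus\{j\}$, or equivalently by its side information graph $G=(V,E)$, the directed graph (no self-loops, no parallel edges) with $V=[1:n]$ and an edge $i\to j$ if and only if $i\in A_j$. Index code: for nonnegative integers $t_1,\dots,t_n$ and a positive integer $r$, a $(t_1,\dots,t_n,r)$ index code for $G$ consists of an encoder $\phi:\prod_{i=1}^n\{0,1\}^{t_i}\to\{0,1\}^r$ and decoders $\psi_j:\{0,1\}^r\times\prod_{k\in A_j}\{0,1\}^{t_k}\to\{0,1\}^{t_j}$, $j\in[1:n]$, such that $\psi_j(\phi(x^n),(x_k)_{k\in A_j})=x_j$ for all $j\in[1:n]$ and all $x^n=(x_1,\dots,x_n)\in\prod_{i=1}^n\{0,1\}^{t_i}$. Capacity region: a tuple $(R_1,\dots,R_n)$ of nonnegative reals is achievable for $G$ if there exists a $(t_1,\dots,t_n,r)$ index code for $G$ with $R_j\le t_j/r$ for all $j\in[1:n]$. The capacity region of $G$ is the closure of the set of achievable rate tuples. Critical edge: an edge $e\in E$ is critical if the capacity region of $(V,E\setminus\{e\})$ is a proper subset of the capacity region of $G$. For $S\subseteq V$, $G|_S$ denotes the vertex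 induced subgraph on $S$. Unicycle: a directed graph is a unicycle if its edge set is a Hamiltonian cycle of it, i.e., its edges are exactly the edges of a single directed cycle visiting every vertex exactly once. Directed cycles have length at least $2$; a pair of opposite edges $i\to j$, $j\to i$ is a directed cycle of length $2$. An edge $e$ of $G$ "belongs to a unicycle" if there is $S\subseteq V$ such that $G|_S$ is a unicycle and $e$ is an edge of $G|_S$. *)

theory Defs
  imports
    "HOL-Analysis.Analysis"
    "HOL-Number_Theory.Cong"
    "Graph_Theory.Digraph_Component"
    "Graph_Theory.Pair_Digraph"
begin

section \<open>Index coding problems\<close>

definition side_info_graph :: "nat \<Rightarrow> (nat \<Rightarrow> nat set) \<Rightarrow> (nat, nat \<times> nat) pre_digraph" where
  "side_info_graph n A =
     with_proj \<lparr>pverts = {1..n}, parcs = {(i, j). j \<in> {1..n} \<and> i \<in> A j}\<rparr>"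

definition side_info :: "('a, 'b) pre_digraph \<Rightarrow> 'a \<Rightarrow> 'a set" where
  "side_info G j = {i. (i, j) \<in> arcs_ends G}"

lemma side_info_side_info_graph:
  assumes "j \<in> {1..n}"
  shows "side_info (side_info_graph n A) j = A j"
  using assms by (auto simp: side_info_def side_info_graph_def)

definition bits :: "nat \<Rightarrow> bool list set" where
  "bits k = {w. length w = k}"

text \<open>
  Message tuples indexed by a set of vertices are extensional functions on that set, so
  passing to the side information of receiver \<open>j\<close> is \<^const>\<open>restrict\<close>.
\<close>

definition index_code ::
  "('a, 'b) pre_digraph \<Rightarrow> ('a \<Rightarrow> nat) \<Rightarrow> nat \<Rightarrow>
   (('a \<Rightarrow> bool list) \<Rightarrow> bool list) \<Rightarrow>
   ('a \<Rightarrow> bool list \<Rightarrow> ('a \<Rightarrow> bool list) \<Rightarrow> bool list) \<Rightarrow> bool" where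
  "index_code G t r \<phi> \<psi> \<longleftrightarrow>
     \<phi> \<in> (\<Pi>\<^sub>E i\<in>verts G. bits (t i)) \<rightarrow> bits r \<and>
     (\<forall>j\<in>verts G. \<psi> j \<in> bits r \<rightarrow> (\<Pi>\<^sub>E k\<in>side_info G j. bits (t k)) \<rightarrow> bits (t j)) \<and>
     (\<forall>j\<in>verts G. \<forall>x\<in>(\<Pi>\<^sub>E i\<in>verts G. bits (t i)).
        \<psi> j (\<phi> x) (restrict x (side_info G j)) = x j)"

definition achievable_rates :: "('a, 'b) pre_digraph \<Rightarrow> ('a \<Rightarrow> real) set" where
  "achievable_rates G =
     {R \<in> (\<Pi>\<^sub>E j\<in>verts G. {0..}).
        \<exists>t r \<phi> \<psi>. 0 < r \<and> index_code G t r \<phi> \<psi> \<and>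
                  (\<forall>j\<in>verts G. R j \<le> real (t j) / real r)}"

text \<open>
  The space of real tuples indexed by the vertices is the product topology on the extensional
  functions; for a finite vertex set this is the Euclidean topology.
\<close>

definition capacity_region :: "('a, 'b) pre_digraph \<Rightarrow> ('a \<Rightarrow> real) set" where
  "capacity_region G = powertop_real (verts G) closure_of achievable_rates G"

definition critical_arc :: "('a, 'b) pre_digraph \<Rightarrow> 'b \<Rightarrow> bool" where
  "critical_arc G e \<longleftrightarrow>
     e \<in> arcs G \<and> capacity_region (pre_digraph.del_arc G e) \<subset> capacity_region G"


section \<open>Unicycles\<close>

text \<open>
  \<^const>\<open>pre_digraph.cycle\<close> already says that no vertex is visited twice. It admits loops,
  hence the bound on the length.
\<close>

definition hamiltonian_cycle :: "('a, 'b) pre_digraph \<Rightarrow> 'b list \<Rightarrow> bool" where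
  "hamiltonian_cycle G p \<longleftrightarrow>
     pre_digraph.cycle G p \<and> 2 \<le> length p \<and> tail G ` set p = verts G"

definition unicycle :: "('a, 'b) pre_digraph \<Rightarrow> bool" where
  "unicycle G \<longleftrightarrow> (\<exists>p. hamiltonian_cycle G p \<and> set p = arcs G)"

definition belongs_to_unicycle :: "('a, 'b) pre_digraph \<Rightarrow> 'b \<Rightarrow> bool" where
  "belongs_to_unicycle G e \<longleftrightarrow>
     (\<exists>S\<subseteq>verts G. unicycle (induce_subgraph G S) \<and> e \<in> arcs (induce_subgraph G S))"


section \<open>Cyclic indices\<close>

definition cyclic_index :: "nat \<Rightarrow> int \<Rightarrow> nat" where
  "cyclic_index n k = nat ((k - 1) mod int n) + 1"

lemma cyclic_index_mem:
  assumes "1 \<le> n"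
  shows "cyclic_index n k \<in> {1..n}"
  using assms pos_mod_bound[of "int n" "k - 1"] by (simp add: cyclic_index_def nat_less_iff Suc_leI)

lemma cyclic_index_cong:
  assumes "1 \<le> n"
  shows "[int (cyclic_index n k) = k] (mod int n)"
  using assms by (simp add: cyclic_index_def cong_def mod_simps)

end

theory Submission
  imports Defs
begin

text \<open>
  If \<open>e\<close> lies on a unicycle on \<open>k\<close> vertices, then rate \<open>1 / (k - 1)\<close> on each of them is achievable
  with \<open>k - 1\<close> parity bits, while without \<open>e\<close> these vertices induce an acyclic graph, which forces
  their rates to sum to at most 1. If \<open>e\<close> lies on no unicycle, then the reverse of \<open>e\<close> is not an
  arc, so the pairs of opposite arcs form a union of paths. A set of vertices containing no such
  pair is acyclic, because the only cycle left is the one through all indices, and that one would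
  make the whole graph a unicycle. Hence the message lengths of a code with \<open>r\<close> bits sum to at
  most \<open>r\<close> over every independent set of the paths; as unions of paths are perfect, a clique cover
  that does not use \<open>e\<close> serves the same message lengths with \<open>r\<close> bits.
\<close>

section \<open>Index codes and the acyclic bound\<close>

lemma mem_side_info_iff:
  "i \<in> side_info G j \<longleftrightarrow> (\<exists>a\<in>arcs G. tail G a = i \<and> head G a = j)"
  by (auto simp: side_info_def arcs_ends_conv)

lemma card_bits: "card (bits k) = 2 ^ k"
  using card_lists_length_eq[of "UNIV :: bool set" k] by (simp add: bits_def)

lemma finite_bits: "finite (bits k)"
  using finite_lists_length_eq[of "UNIV :: bool set" k] by (simp add: bits_def)

text \<open>A decoder sees only the codeword and its side information, so tuples that agree on both
  are decoded alike.\<close>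

lemma index_code_inj:
  assumes "index_code G t r \<phi> \<psi>" and "j \<in> verts G"
    and "x \<in> (\<Pi>\<^sub>E i\<in>verts G. bits (t i))" and "y \<in> (\<Pi>\<^sub>E i\<in>verts G. bits (t i))"
    and "\<phi> x = \<phi> y" and "\<And>k. k \<in> side_info G j \<Longrightarrow> x k = y k"
  shows "x j = y j"
proof -
  have "restrict x (side_info G j) = restrict y (side_info G j)"
    using assms(6) by (intro restrict_ext) auto
  moreover have "\<psi> j (\<phi> x) (restrict x (side_info G j)) = x j"
    "\<psi> j (\<phi> y) (restrict y (side_info G j)) = y j"
    using assms(1-4) by (auto simp: index_code_def)
  ultimately show ?thesis using assms(5) by simp
qed

text \<open>Converse of \<open>index_code_inj\<close>: a decoder can answer according to any message
  tuple consistent with what it sees. Codes can thus be built from the encoder alone.\<close>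

lemma ex_index_codeI:
  assumes enc: "\<phi> \<in> (\<Pi>\<^sub>E i\<in>verts G. bits (t i)) \<rightarrow> bits r"
    and dec: "\<And>j x y. j \<in> verts G \<Longrightarrow> x \<in> (\<Pi>\<^sub>E i\<in>verts G. bits (t i)) \<Longrightarrow>
      y \<in> (\<Pi>\<^sub>E i\<in>verts G. bits (t i)) \<Longrightarrow> \<phi> x = \<phi> y \<Longrightarrow>
      (\<And>k. k \<in> side_info G j \<Longrightarrow> x k = y k) \<Longrightarrow> x j = y j"
  shows "\<exists>\<psi>. index_code G t r \<phi> \<psi>"
proof -
  let ?X = "\<Pi>\<^sub>E i\<in>verts G. bits (t i)"
  define P where "P j w z x \<longleftrightarrow> x \<in> ?X \<and> \<phi> x = w \<and> restrict x (side_info G j) = z" for j w z x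
  \<comment> \<open>The all-\<open>False\<close> word covers inputs that no message tuple produces;
    it only keeps the value in \<open>bits (t j)\<close>.\<close>
  define \<psi> where "\<psi> j w z =
    (if \<exists>x. P j w z x then (SOME x. P j w z x) j else replicate (t j) False)" for j w z
  have "\<psi> j w z \<in> bits (t j)" if "j \<in> verts G" for j w z
  proof (cases "\<exists>x. P j w z x")
    case True
    then have "P j w z (SOME x. P j w z x)" by (rule someI_ex)
    then have "(SOME x. P j w z x) \<in> ?X" by (simp add: P_def)
    then show ?thesis using that True by (auto simp: \<psi>_def)
  qed (auto simp: \<psi>_def bits_def)
  moreover have "\<psi> j (\<phi> x) (restrict x (side_info G j)) = x j" if "j \<in> verts G" "x \<in> ?X" for j x
  proof -
    let ?w = "\<phi> x" and ?z = "restrict x (side_info G j)"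
    have ex: "\<exists>y. P j ?w ?z y" using that by (auto simp: P_def)
    then have P: "P j ?w ?z (SOME y. P j ?w ?z y)" by (rule someI_ex)
    have "(SOME y. P j ?w ?z y) j = x j"
    proof (rule dec[of j "SOME y. P j ?w ?z y" x])
      fix k assume k: "k \<in> side_info G j"
      have "restrict (SOME y. P j ?w ?z y) (side_info G j) k = ?z k" using P by (simp add: P_def)
      then show "(SOME y. P j ?w ?z y) k = x k" using k by simp
    qed (use P that in \<open>auto simp: P_def\<close>)
    then show ?thesis using ex by (simp add: \<psi>_def)
  qed
  ultimately have "index_code G t r \<phi> \<psi>" using enc by (auto simp: index_code_def)
  then show ?thesis by blast
qed

text \<open>The last hypothesis expresses acyclicity of the subgraph on \<open>S\<close>. With the
  messages outside \<open>S\<close> frozen, a source of the set where two tuples differ would be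
  decoded alike for equal codewords, so the encoder is injective on \<open>2 ^ sum t S\<close>
  tuples.\<close>

lemma index_code_acyclic_bound:
  assumes code: "index_code G t r \<phi> \<psi>" and S: "finite S" "S \<subseteq> verts G"
    and acyc: "\<And>T. T \<subseteq> S \<Longrightarrow> T \<noteq> {} \<Longrightarrow> \<exists>j\<in>T. side_info G j \<inter> T = {}"
  shows "sum t S \<le> r"
proof -
  let ?X = "\<Pi>\<^sub>E i\<in>verts G. bits (t i)" and ?Z = "\<Pi>\<^sub>E i\<in>S. bits (t i)"
  define ext where "ext z = (\<lambda>i\<in>verts G. if i \<in> S then z i else replicate (t i) False)"
    for z :: "'a \<Rightarrow> bool list"
  have ext: "ext z \<in> ?X" if "z \<in> ?Z" for z
    using that by (auto simp: ext_def bits_def PiE_iff)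
  have "inj_on (\<lambda>z. \<phi> (ext z)) ?Z"
  proof (rule inj_onI)
    fix z z' assume z: "z \<in> ?Z" "z' \<in> ?Z" and eq: "\<phi> (ext z) = \<phi> (ext z')"
    define T where "T = {j \<in> S. z j \<noteq> z' j}"
    have "T = {}"
    proof (rule ccontr)
      assume "T \<noteq> {}"
      then obtain j where j: "j \<in> T" "side_info G j \<inter> T = {}"
        using acyc[of T] by (auto simp: T_def)
      have agree: "ext z k = ext z' k" if "k \<in> side_info G j" for k
        using that j(2) by (auto simp: ext_def T_def)
      have "j \<in> verts G" using j(1) S by (auto simp: T_def)
      then have "ext z j = ext z' j"
        using index_code_inj[OF code _ ext[OF z(1)] ext[OF z(2)] eq, of j] agree by blast
      then show False using j(1) S(2) by (auto simp: ext_def T_def split: if_splits)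
    qed
    then show "z = z'" by (auto simp: T_def intro: PiE_ext[OF z])
  qed
  moreover have "(\<lambda>z. \<phi> (ext z)) ` ?Z \<subseteq> bits r"
  proof (rule image_subsetI)
    have "\<phi> \<in> ?X \<rightarrow> bits r" using code by (simp add: index_code_def)
    then show "\<phi> (ext z) \<in> bits r" if "z \<in> ?Z" for z
      using ext[OF that] by (rule funcset_mem)
  qed
  ultimately have "card ?Z \<le> card (bits r)"
    by (rule card_inj_on_le) (rule finite_bits)
  moreover have "card ?Z = 2 ^ sum t S"
    using S(1) by (simp add: card_PiE card_bits power_sum)
  ultimately show ?thesis by (simp add: card_bits)
qed

section \<open>Clique cover and parity codes\<close>

text \<open>
  Bit \<open>c\<close> of the codeword is the parity of the message bits placed at position \<open>c\<close>.
\<close>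

lemma ex_index_code_intervals:
  fixes s t :: "'a \<Rightarrow> nat"
  assumes fin: "finite (verts G)"
    and bound: "\<And>j. j \<in> verts G \<Longrightarrow> s j + t j \<le> r"
    and meet: "\<And>i j. i \<in> verts G \<Longrightarrow> j \<in> verts G \<Longrightarrow> i \<noteq> j \<Longrightarrow>
      {s i..<s i + t i} \<inter> {s j..<s j + t j} \<noteq> {} \<Longrightarrow> i \<in> side_info G j"
  shows "\<exists>\<phi> \<psi>. index_code G t r \<phi> \<psi>"
proof -
  define D where "D x c = {i \<in> verts G. c \<in> {s i..<s i + t i} \<and> x i ! (c - s i)}"
    for x :: "'a \<Rightarrow> bool list" and c
  define \<phi> where "\<phi> x = map (\<lambda>c. odd (card (D x c))) [0..<r]" for x
  have "\<exists>\<psi>. index_code G t r \<phi> \<psi>"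
  proof (rule ex_index_codeI)
    show "\<phi> \<in> (\<Pi>\<^sub>E i\<in>verts G. bits (t i)) \<rightarrow> bits r" by (auto simp: \<phi>_def bits_def)
    fix j x y
    assume j: "j \<in> verts G" and x: "x \<in> (\<Pi>\<^sub>E i\<in>verts G. bits (t i))"
      and y: "y \<in> (\<Pi>\<^sub>E i\<in>verts G. bits (t i))" and eq: "\<phi> x = \<phi> y"
      and known: "\<And>k. k \<in> side_info G j \<Longrightarrow> x k = y k"
    have len: "length (x j) = t j" "length (y j) = t j" using x y j by (auto simp: bits_def)
    show "x j = y j"
    proof (rule nth_equalityI)
      fix b assume "b < length (x j)"
      then have b: "b < t j" using len by simp
      define c where "c = s j + b"
      have c: "c < r" "c \<in> {s j..<s j + t j}" using bound[OF j] b by (auto simp: c_def)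
      have parity: "odd (card (D x c)) \<longleftrightarrow> odd (card (D y c))"
        using arg_cong[OF eq, of "\<lambda>w. w ! c"] c by (simp add: \<phi>_def)
      \<comment> \<open>Every other message placed at \<open>c\<close> is known to receiver
        \<open>j\<close>, so \<open>R\<close> is the same for \<open>x\<close> and \<open>y\<close>,
        and the parity reveals the remaining bit.\<close>
      define R where "R = D x c - {j}"
      have R: "R = D y c - {j}"
      proof -
        have "x i = y i" if "i \<in> verts G" "i \<noteq> j" "c \<in> {s i..<s i + t i}" for i
          using known meet[OF that(1) j that(2)] that(3) c(2) by blast
        then show ?thesis by (auto simp: R_def D_def)
      qed
      have fR: "finite R" "j \<notin> R" using fin by (auto simp: R_def D_def)
      have split: "card (D z c) = card R + of_bool (z j ! b)" if "R = D z c - {j}" for z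
      proof (cases "z j ! b")
        case True
        then have "D z c = insert j R" using that j c(2) by (auto simp: D_def c_def)
        then show ?thesis using fR True by simp
      next
        case False
        then have "D z c = R" using that by (auto simp: D_def c_def)
        then show ?thesis using False by simp
      qed
      show "x j ! b = y j ! b"
        using parity split[OF R_def] split[OF R] by (cases "x j ! b"; cases "y j ! b") auto
    qed (use len in simp)
  qed
  then show ?thesis by blast
qed

text \<open>
  Sending the sums of consecutive messages in some enumeration of \<open>S\<close> reveals everything up
  to a simultaneous flip of all messages, so one known message suffices.
\<close>

lemma achievable_rates_parity:
  assumes S: "S \<subseteq> verts G" "card S = k" "2 \<le> k"
    and side: "\<And>j. j \<in> S \<Longrightarrow> side_info G j \<inter> S \<noteq> {}"
  shows "(\<lambda>j\<in>verts G. if j \<in> S then 1 / real (k - 1) else 0) \<in> achievable_rates G"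
proof -
  define t :: "'a \<Rightarrow> nat" where "t j = (if j \<in> S then 1 else 0)" for j
  have "finite S" using S by (metis card.infinite not_numeral_le_zero)
  then obtain h where h: "bij_betw h {0..<k} S"
    using ex_bij_betw_nat_finite S(2) by blast
  define \<phi> :: "('a \<Rightarrow> bool list) \<Rightarrow> bool list"
    where "\<phi> x = map (\<lambda>i. x (h i) \<noteq> x (h (Suc i))) [0..<k-1]" for x
  have "\<exists>\<psi>. index_code G t (k - 1) \<phi> \<psi>"
  proof (rule ex_index_codeI)
    show "\<phi> \<in> (\<Pi>\<^sub>E i\<in>verts G. bits (t i)) \<rightarrow> bits (k - 1)" by (auto simp: \<phi>_def bits_def)
    fix j x y
    assume j: "j \<in> verts G" and x: "x \<in> (\<Pi>\<^sub>E i\<in>verts G. bits (t i))"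
      and y: "y \<in> (\<Pi>\<^sub>E i\<in>verts G. bits (t i))" and eq: "\<phi> x = \<phi> y"
      and known: "\<And>k. k \<in> side_info G j \<Longrightarrow> x k = y k"
    have len: "length (x i) = t i" "length (y i) = t i" if "i \<in> verts G" for i
      using x y that by (auto simp: bits_def)
    show "x j = y j"
    proof (cases "j \<in> S")
      case False
      then show ?thesis using len[OF j] by (simp add: t_def)
    next
      case True
      have one: "\<exists>b c. x i = [b] \<and> y i = [c]" if "i \<in> S" for i
        using len[of i] that S(1) by (auto simp: t_def length_Suc_conv)
      \<comment> \<open>Messages on \<open>S\<close> are single bits: if their sum is unchanged,
        both summands are flipped or neither is.\<close>
      have step: "x (h i) = y (h i) \<longleftrightarrow> x (h (Suc i)) = y (h (Suc i))" if "Suc i < k" for i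
      proof -
        have "h i \<in> S" "h (Suc i) \<in> S" using h that by (auto simp: bij_betw_def)
        moreover have "(x (h i) \<noteq> x (h (Suc i))) = (y (h i) \<noteq> y (h (Suc i)))"
          using arg_cong[OF eq, of "\<lambda>w. w ! i"] that
          by (simp add: \<phi>_def del: map_upt_Suc nth_upt) (simp add: nth_upt)
        ultimately show ?thesis using one[of "h i"] one[of "h (Suc i)"] by auto
      qed
      have const: "x (h i) = y (h i) \<longleftrightarrow> x (h 0) = y (h 0)" if "i < k" for i
        using that
      proof (induction i)
        case (Suc i)
        then show ?case using step[of i] by simp
      qed simp
      have const': "x i = y i \<longleftrightarrow> x (h 0) = y (h 0)" if "i \<in> S" for i
      proof -
        have "i \<in> h ` {0..<k}" using h that by (simp add: bij_betw_def)
        then obtain m where "m < k" "h m = i" by auto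
        then show ?thesis using const by blast
      qed
      obtain i where "i \<in> side_info G j" "i \<in> S" using side[OF True] by blast
      then show ?thesis using known const'[of i] const'[OF True] by blast
    qed
  qed
  then obtain \<psi> where "index_code G t (k - 1) \<phi> \<psi>" by blast
  then show ?thesis
    unfolding achievable_rates_def using S(3)
    by (intro CollectI conjI exI[of _ t] exI[of _ "k - 1"] exI[of _ \<phi>] exI[of _ \<psi>])
      (auto simp: t_def)
qed

section \<open>Colouring unions of paths\<close>

text \<open>Dynamic program for the weight of a heaviest independent set among the first vertices of
  the paths: the last vertex is left out, or taken without its joined predecessor.\<close>

fun path_weight :: "(nat \<Rightarrow> bool) \<Rightarrow> (nat \<Rightarrow> nat) \<Rightarrow> nat \<Rightarrow> nat" where
  "path_weight E t 0 = 0"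
| "path_weight E t (Suc 0) = t 0"
| "path_weight E t (Suc (Suc k)) =
     (if E k then max (path_weight E t (Suc k)) (path_weight E t k + t (Suc k))
      else path_weight E t (Suc k) + t (Suc k))"

lemma path_weight_mono: "k \<le> l \<Longrightarrow> path_weight E t k \<le> path_weight E t l"
proof (rule lift_Suc_mono_le[of "path_weight E t"])
  show "path_weight E t n \<le> path_weight E t (Suc n)" for n by (cases n) auto
qed

text \<open>Tracing the choices of the recursion back yields an optimal independent set.\<close>

lemma path_weight_attained:
  "\<exists>I\<subseteq>{..<m}. sum t I = path_weight E t m \<and> (\<forall>k. k \<in> I \<and> Suc k \<in> I \<longrightarrow> \<not> E k)"
proof (induction E t m rule: path_weight.induct)
  case (2 E t)
  show ?case by (intro exI[of _ "{0}"]) auto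
next
  case (3 E t k)
  obtain I where I: "I \<subseteq> {..<Suc k}" "sum t I = path_weight E t (Suc k)"
      "\<forall>k. k \<in> I \<and> Suc k \<in> I \<longrightarrow> \<not> E k"
    using 3 by (cases "E k") blast+
  show ?case
  proof (cases "E k")
    case False
    have "finite I" "Suc k \<notin> I" using I(1) finite_subset by auto
    then show ?thesis using I False
      by (intro exI[of _ "insert (Suc k) I"]) auto
  next
    case True
    then obtain J where J: "J \<subseteq> {..<k}" "sum t J = path_weight E t k"
        "\<forall>k. k \<in> J \<and> Suc k \<in> J \<longrightarrow> \<not> E k"
      using 3 by blast
    have fin: "finite J" "Suc k \<notin> J" using J(1) finite_subset by auto
    show ?thesis
    proof (cases "path_weight E t k + t (Suc k) \<le> path_weight E t (Suc k)")
      case True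
      then show ?thesis using I \<open>E k\<close> by (intro exI[of _ I]) auto
    next
      case False
      then show ?thesis using J \<open>E k\<close> fin
        by (intro exI[of _ "insert (Suc k) J"]) auto
    qed
  qed
qed auto

text \<open>
  Weighted colouring of the complement of a disjoint union of paths with as many colours as the
  weight of a heaviest independent set of the paths; \<open>E k\<close> says that \<open>k\<close> and \<open>Suc k\<close> are joined.
\<close>

lemma ex_interval_colouring:
  fixes E :: "nat \<Rightarrow> bool" and t :: "nat \<Rightarrow> nat"
  shows "\<exists>s I. I \<subseteq> {..<m} \<and> (\<forall>k. k \<in> I \<and> Suc k \<in> I \<longrightarrow> \<not> E k) \<and>
    (\<forall>k<m. s k + t k \<le> sum t I) \<and>
    (\<forall>k l. k < l \<longrightarrow> \<not> (l = Suc k \<and> E k) \<longrightarrow> s k + t k \<le> s l)"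
proof -
  \<comment> \<open>The interval of \<open>k\<close> starts at the optimum over the earlier vertices
    not joined to \<open>k\<close>, hence ends at or below the optimum over all vertices up to
    \<open>k\<close>.\<close>
  define s where "s k = (case k of 0 \<Rightarrow> 0 | Suc i \<Rightarrow> path_weight E t (if E i then i else k))" for k
  have top: "s k + t k \<le> path_weight E t (Suc k)" for k
    by (cases k) (auto simp: s_def)
  have "s k + t k \<le> s l" if kl: "k < l" "\<not> (l = Suc k \<and> E k)" for k l
  proof -
    obtain i where i: "l = Suc i" using kl(1) by (cases l) auto
    \<comment> \<open>Since \<open>k\<close> is not joined to \<open>l\<close>, it is among the
      vertices counted in \<open>s l\<close>.\<close>
    have "path_weight E t (Suc k) \<le> s l"
      using kl i by (auto simp: s_def intro!: path_weight_mono)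
        (use less_Suc_eq_le in \<open>auto simp: le_eq_less_or_eq\<close>)
    then show ?thesis using top[of k] by linarith
  qed
  moreover obtain I where I: "I \<subseteq> {..<m}" "sum t I = path_weight E t m"
      "\<forall>k. k \<in> I \<and> Suc k \<in> I \<longrightarrow> \<not> E k"
    using path_weight_attained by blast
  moreover have "s k + t k \<le> sum t I" if "k < m" for k
    using top[of k] path_weight_mono[of "Suc k" m E t] that I(2) by simp
  ultimately show ?thesis by blast
qed

section \<open>Capacity regions\<close>

lemma achievable_rates_mono:
  assumes "verts H = verts G"
    and "\<And>t r \<phi> \<psi>. index_code H t r \<phi> \<psi> \<Longrightarrow> \<exists>\<phi>' \<psi>'. index_code G t r \<phi>' \<psi>'"
  shows "achievable_rates H \<subseteq> achievable_rates G"
  unfolding achievable_rates_def assms(1) by (intro Collect_mono) (metis assms(2))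

lemma capacity_region_mono:
  assumes "verts H = verts G"
    and "\<And>t r \<phi> \<psi>. index_code H t r \<phi> \<psi> \<Longrightarrow> \<exists>\<phi>' \<psi>'. index_code G t r \<phi>' \<psi>'"
  shows "capacity_region H \<subseteq> capacity_region G"
  unfolding capacity_region_def assms(1)
  by (intro closure_of_mono achievable_rates_mono assms)

lemma ex_index_code_side_info_mono:
  assumes "index_code H t r \<phi> \<psi>" "verts H = verts G"
    and "\<And>j. j \<in> verts G \<Longrightarrow> side_info H j \<subseteq> side_info G j"
  shows "\<exists>\<psi>'. index_code G t r \<phi> \<psi>'"
proof (rule ex_index_codeI)
  show "\<phi> \<in> (\<Pi>\<^sub>E i\<in>verts G. bits (t i)) \<rightarrow> bits r" using assms(1,2) by (simp add: index_code_def)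
next
  fix j x y
  assume "j \<in> verts G" "x \<in> (\<Pi>\<^sub>E i\<in>verts G. bits (t i))" "y \<in> (\<Pi>\<^sub>E i\<in>verts G. bits (t i))"
    "\<phi> x = \<phi> y" "\<And>k. k \<in> side_info G j \<Longrightarrow> x k = y k"
  then show "x j = y j"
    using index_code_inj[OF assms(1), of j x y] assms(2) assms(3)[of j] by (simp add: subset_iff)
qed

text \<open>The bound for codes is a linear inequality on rates, which defines a closed set and so
  passes to the closure.\<close>

lemma capacity_region_acyclic_bound:
  assumes S: "finite S" "S \<subseteq> verts G"
    and acyc: "\<And>T. T \<subseteq> S \<Longrightarrow> T \<noteq> {} \<Longrightarrow> \<exists>j\<in>T. side_info G j \<inter> T = {}"
    and R: "R \<in> capacity_region G"
  shows "sum R S \<le> 1"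
proof -
  let ?X = "powertop_real (verts G)"
  let ?C = "{R \<in> topspace ?X. (\<Sum>j\<in>S. R j) \<in> {..1}}"
  have "continuous_map ?X euclideanreal (\<lambda>R. \<Sum>j\<in>S. R j)"
    using S by (intro continuous_map_sum continuous_map_product_projection) auto
  then have "closedin ?X ?C"
    by (rule closedin_continuous_map_preimage) auto
  moreover have "achievable_rates G \<subseteq> ?C"
  proof
    fix Q assume Q: "Q \<in> achievable_rates G"
    then obtain t r \<phi> \<psi> where 1: "0 < r" "index_code G t r \<phi> \<psi>"
        "\<And>j. j \<in> verts G \<Longrightarrow> Q j \<le> real (t j) / real r"
      by (auto simp: achievable_rates_def)
    have "sum Q S \<le> (\<Sum>j\<in>S. real (t j) / real r)"
      using S 1(3) by (intro sum_mono) auto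
    also have "\<dots> = real (sum t S) / real r" by (simp add: sum_divide_distrib)
    also have "\<dots> \<le> 1" using index_code_acyclic_bound[OF 1(2) S acyc] 1(1) by (simp del: of_nat_sum)
    finally show "Q \<in> ?C" using Q by (auto simp: achievable_rates_def PiE_def)
  qed
  ultimately have "capacity_region G \<subseteq> ?C"
    unfolding capacity_region_def by (intro closure_of_minimal)
  then show ?thesis using R by auto
qed

lemma achievable_rates_subset_capacity_region:
  "achievable_rates G \<subseteq> capacity_region G"
  unfolding capacity_region_def
  by (rule closure_of_subset) (auto simp: achievable_rates_def PiE_def)

section \<open>Unicycles are critical\<close>

context pre_digraph
begin

text \<open>Take the first vertex of the path in \<open>T\<close>: the only path arc entering it, if
  any, comes from an earlier vertex.\<close>

lemma path_subset_source:
  assumes "cas a q b" "distinct (a # map (head G) q)"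
    and "T \<subseteq> insert a (head G ` set q)" "T \<noteq> {}"
  shows "\<exists>j\<in>T. \<forall>f\<in>set q. head G f = j \<longrightarrow> tail G f \<notin> T"
  using assms
proof (induction q arbitrary: a)
  case (Cons f q)
  show ?case
  proof (cases "a \<in> T")
    case True
    then show ?thesis using Cons.prems(2) by (intro bexI[of _ a]) auto
  next
    case False
    have "\<exists>j\<in>T. \<forall>f\<in>set q. head G f = j \<longrightarrow> tail G f \<notin> T"
      using Cons.prems False by (intro Cons.IH[of "head G f"]) auto
    then show ?thesis using False Cons.prems(1) by auto
  qed
qed auto

lemma cas_end: "cas u p v \<Longrightarrow> awlast u p = v"
  by (induction p arbitrary: u) auto

lemma cas_tails: "cas u p v \<Longrightarrow> tail G ` set p \<subseteq> insert u (head G ` set p)"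
  by (induction p arbitrary: u) auto

lemma cas_last: "cas u p v \<Longrightarrow> p \<noteq> [] \<Longrightarrow> v \<in> head G ` set p"
proof (induction p arbitrary: u)
  case (Cons f p)
  then show ?case by (cases "p = []") auto
qed simp

lemma cycle_heads:
  assumes "cycle p"
  shows "distinct (map (head G) p)" "tail G ` set p \<subseteq> head G ` set p"
proof -
  obtain u where u: "awalk u p u" "distinct (tl (awalk_verts u p))" "p \<noteq> []"
    using assms by (auto simp: cycle_def)
  then show "distinct (map (head G) p)" by (auto simp: awalk_verts_conv' awalk_def)
  show "tail G ` set p \<subseteq> head G ` set p"
    using cas_tails cas_last u by (fastforce simp: awalk_def)
qed

text \<open>Without \<open>e\<close> the cycle opens into a path from the head of \<open>e\<close>
  to its tail, to which \<open>path_subset_source\<close> applies.\<close>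

lemma cycle_minus_arc_source:
  assumes "cycle p" "e \<in> set p" "T \<subseteq> head G ` set p" "T \<noteq> {}"
  shows "\<exists>j\<in>T. \<forall>f\<in>set p - {e}. head G f = j \<longrightarrow> tail G f \<notin> T"
proof -
  obtain u where u: "cas u p u" using assms(1) by (auto simp: cycle_def awalk_def)
  obtain p1 p2 where p: "p = p1 @ e # p2" using assms(2) by (auto dest: split_list)
  have "cas (head G e) (p2 @ p1) (tail G e)"  using u p cas_end by auto
  moreover have "distinct (head G e # map (head G) (p2 @ p1))"
    using cycle_heads(1)[OF assms(1)] p by auto
  moreover have "T \<subseteq> insert (head G e) (head G ` set (p2 @ p1))" using assms(3) p by auto
  ultimately have "\<exists>j\<in>T. \<forall>f\<in>set (p2 @ p1). head G f = j \<longrightarrow> tail G f \<notin> T"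
    using assms(4) by (rule path_subset_source)
  then show ?thesis using p by auto
qed

end

lemma belongs_to_unicycle_imp_critical:
  assumes "belongs_to_unicycle G e"
  shows "critical_arc G e"
proof -
  obtain S p where S: "S \<subseteq> verts G" and p: "hamiltonian_cycle (induce_subgraph G S) p"
      "set p = arcs (induce_subgraph G S)" and e: "e \<in> arcs (induce_subgraph G S)"
    using assms by (auto simp: belongs_to_unicycle_def unicycle_def)
  let ?H = "induce_subgraph G S" and ?D = "pre_digraph.del_arc G e"
  have cyc: "pre_digraph.cycle ?H p" and len: "2 \<le> length p" and tails: "tail G ` set p = S"
    using p(1) by (auto simp: hamiltonian_cycle_def)
  have arcs: "set p = {a \<in> arcs G. tail G a \<in> S \<and> head G a \<in> S}" using p(2) by simp
  have heads: "distinct (map (head G) p)" "S \<subseteq> head G ` set p"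
    using pre_digraph.cycle_heads[OF cyc] tails by auto
  have S_eq: "S = head G ` set p" using heads(2) arcs by auto
  then have card: "card S = length p"
    using distinct_card[OF heads(1)] by simp
  have fin: "finite S" using S_eq by simp
  have side_D: "i \<in> side_info ?D j \<longleftrightarrow> (\<exists>a\<in>arcs G - {e}. tail G a = i \<and> head G a = j)" for i j
    by (simp add: mem_side_info_iff pre_digraph.del_arc_simps)
  have vD: "verts ?D = verts G" by (simp add: pre_digraph.del_arc_simps)
  \<comment> \<open>This tuple separates the two regions: its sum over \<open>S\<close> is
    \<open>length p / (length p - 1)\<close>, which exceeds 1.\<close>
  let ?R = "\<lambda>j\<in>verts G. if j \<in> S then 1 / real (length p - 1) else 0"
  have "?R \<in> achievable_rates G"
  proof (rule achievable_rates_parity[OF S card len])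
    fix j assume "j \<in> S"
    then obtain f where "f \<in> set p" "head G f = j" using heads by auto
    then have "tail G f \<in> side_info G j \<inter> S" using arcs by (auto simp: mem_side_info_iff)
    then show "side_info G j \<inter> S \<noteq> {}" by blast
  qed
  then have "?R \<in> capacity_region G" using achievable_rates_subset_capacity_region by blast
  moreover have "?R \<notin> capacity_region ?D"
  proof
    assume R: "?R \<in> capacity_region ?D"
    have "sum ?R S \<le> 1"
    proof (rule capacity_region_acyclic_bound[OF fin _ _ R])
      show "S \<subseteq> verts ?D" using S vD by simp
      fix T assume T: "T \<subseteq> S" "T \<noteq> {}"
      have "e \<in> set p" using e p(2) by simp
      then obtain j where j: "j \<in> T" "\<forall>f\<in>set p - {e}. head G f = j \<longrightarrow> tail G f \<notin> T"
        using pre_digraph.cycle_minus_arc_source[OF cyc, of e T] T S_eq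
        unfolding induce_subgraph_head induce_subgraph_tail by blast
      \<comment> \<open>The cycle has no chords, so a source for its arcs is a source for all arcs
        inside \<open>T\<close>.\<close>
      have "a \<in> set p" if "a \<in> arcs G" "tail G a \<in> T" "head G a = j" for a
        using that j(1) T(1) arcs by blast
      then have "tail G a \<notin> T" if "a \<in> arcs G - {e}" "head G a = j" for a
        using that j(2) by blast
      then have "side_info ?D j \<inter> T = {}" unfolding disjoint_iff side_D by blast
      then show "\<exists>j\<in>T. side_info ?D j \<inter> T = {}" using j(1) by blast
    qed
    moreover have "sum ?R S = (\<Sum>j\<in>S. 1 / real (length p - 1))"
      using S by (intro sum.cong) auto
    ultimately have "real (length p) / real (length p - 1) \<le> 1" by (simp add: card)
    then show False using len by (simp add: field_simps of_nat_diff)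
  qed
  moreover have "capacity_region ?D \<subseteq> capacity_region G"
  proof (rule capacity_region_mono[OF vD])
    fix t r \<phi> \<psi> assume code: "index_code ?D t r \<phi> \<psi>"
    have "side_info ?D j \<subseteq> side_info G j" for j
      unfolding subset_iff side_D mem_side_info_iff[of _ G] by blast
    then show "\<exists>\<phi>' \<psi>'. index_code G t r \<phi>' \<psi>'"
      using ex_index_code_side_info_mono[OF code vD] by blast
  qed
  ultimately show ?thesis using e by (auto simp: critical_arc_def)
qed

section \<open>Cyclic side information\<close>

lemma cyclic_index_eq_iff:
  assumes "1 \<le> n"
  shows "cyclic_index n k = cyclic_index n l \<longleftrightarrow> [k = l] (mod int n)"
proof
  assume "cyclic_index n k = cyclic_index n l"
  then show "[k = l] (mod int n)"
    using cyclic_index_cong[OF assms, of k] cyclic_index_cong[OF assms, of l]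
    by (metis cong_sym cong_trans)
next
  assume "[k = l] (mod int n)"
  then have "[k - 1 = l - 1] (mod int n)" by (intro cong_diff cong_refl)
  then show "cyclic_index n k = cyclic_index n l" by (simp add: cyclic_index_def cong_def)
qed

lemma cyclic_index_add:
  assumes "1 \<le> n"
  shows "cyclic_index n (int (cyclic_index n k) + d) = cyclic_index n (k + d)"
  using assms cyclic_index_cong[OF assms, of k] by (simp add: cyclic_index_eq_iff cong_add)

lemma cyclic_index_of_nat:
  assumes "j \<in> {1..n}"
  shows "cyclic_index n (int j) = j"
  using assms by (simp add: cyclic_index_def nat_diff_distrib)

lemma inj_on_cyclic_index:
  assumes "1 \<le> n" and d: "d = 1 \<or> d = -1"
  shows "inj_on (\<lambda>m. cyclic_index n (a + d * int m)) {..<n}"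
proof (rule inj_onI)
  fix k l
  assume kl: "k \<in> {..<n}" "l \<in> {..<n}"
    and "cyclic_index n (a + d * int k) = cyclic_index n (a + d * int l)"
  then have "int n dvd d * (int k - int l)"
    using assms(1) by (simp add: cyclic_index_eq_iff cong_iff_dvd_diff algebra_simps)
  then have "int n dvd int k - int l" using d by (auto simp: dvd_diff_commute)
  then have "[int k = int l] (mod int n)" by (simp add: cong_iff_dvd_diff)
  then show "k = l" using kl by (simp add: cong_int_iff cong_less_modulus_unique_nat)
qed

lemma range_cyclic_index:
  assumes "1 \<le> n" and d: "d = 1 \<or> d = -1"
  shows "(\<lambda>m. cyclic_index n (a + d * int m)) ` {..<n} = {1..n}"
proof (rule card_subset_eq)
  show "(\<lambda>m. cyclic_index n (a + d * int m)) ` {..<n} \<subseteq> {1..n}"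
    using cyclic_index_mem[OF assms(1)] by blast
  show "card ((\<lambda>m. cyclic_index n (a + d * int m)) ` {..<n}) = card {1..n}"
    by (simp add: card_image inj_on_cyclic_index[OF assms])
qed simp

lemma verts_side_info_graph: "verts (side_info_graph n A) = {1..n}"
  by (simp add: side_info_graph_def)

lemma arcs_side_info_graph: "arcs (side_info_graph n A) = {(i, j). j \<in> {1..n} \<and> i \<in> A j}"
  by (simp add: side_info_graph_def)

lemma tail_side_info_graph: "tail (side_info_graph n A) = fst"
  and head_side_info_graph: "head (side_info_graph n A) = snd"
  by (simp_all add: side_info_graph_def)

lemmas side_info_graph_simps =
  verts_side_info_graph arcs_side_info_graph tail_side_info_graph head_side_info_graph

lemma side_info_del_arc:
  assumes "j \<in> {1..n}"
  shows "side_info (pre_digraph.del_arc (side_info_graph n A) e) j = {i \<in> A j. (i, j) \<noteq> e}"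
  using assms
  by (force simp: mem_side_info_iff pre_digraph.del_arc_simps side_info_graph_simps)

section \<open>Side information from cyclic neighbours\<close>

locale cyclic_side_info =
  fixes n :: nat and A :: "nat \<Rightarrow> nat set"
  assumes n: "1 \<le> n"
    and A: "\<And>j. j \<in> {1..n} \<Longrightarrow> A j \<subseteq> {1..n} - {j}"
    and A_cyclic: "\<And>j. j \<in> {1..n} \<Longrightarrow>
      A j \<subseteq> {cyclic_index n (int j - 1), cyclic_index n (int j + 1)}"
begin

abbreviation G where "G \<equiv> side_info_graph n A"

text \<open>Records an arc as a signed step, so that walks become sums of signs. For
  \<open>n = 2\<close> both signs name the same vertex.\<close>

lemma neighbour:
  assumes "u \<in> A (cyclic_index n k)"
  obtains d :: int where "d = 1 \<or> d = -1" "u = cyclic_index n (k + d)"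
proof -
  have "u = cyclic_index n (k + -1) \<or> u = cyclic_index n (k + 1)"
    using A_cyclic[OF cyclic_index_mem[OF n], of k] assms
      cyclic_index_add[OF n, of k "-1"] cyclic_index_add[OF n, of k 1] by auto
  then show ?thesis using that by blast
qed

text \<open>Without self-loops, the two arcs are all the arcs on \<open>{u, v}\<close> and form a
  cycle of length 2.\<close>

lemma opposite_arcs_belong_to_unicycle:
  assumes "u \<in> {1..n}" "v \<in> {1..n}" "u \<in> A v" "v \<in> A u"
  shows "belongs_to_unicycle G (u, v)"
proof -
  let ?H = "induce_subgraph G {u, v}" and ?p = "[(u, v), (v, u)]"
  have ne: "u \<noteq> v" using A assms by blast
  have arcs: "arcs ?H = {(u, v), (v, u)}"
    using assms A[of u] A[of v] by (auto simp: side_info_graph_simps)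
  have "pre_digraph.awalk ?H u ?p u"
    using arcs by (simp add: pre_digraph.awalk_def pre_digraph.cas.simps side_info_graph_simps)
  then have "pre_digraph.cycle ?H ?p"
    using ne by (auto simp: pre_digraph.cycle_def pre_digraph.awalk_verts.simps
        side_info_graph_simps intro!: exI[of _ u])
  then have "hamiltonian_cycle ?H ?p"
    by (auto simp: hamiltonian_cycle_def side_info_graph_simps)
  then have "unicycle ?H" using arcs unfolding unicycle_def by (intro exI[of _ ?p]) auto
  moreover have "(u, v) \<in> arcs ?H" "{u, v} \<subseteq> verts G"
    unfolding arcs using assms by (simp_all add: verts_side_info_graph)
  ultimately show ?thesis unfolding belongs_to_unicycle_def by blast
qed

text \<open>
  Following arcs backwards inside \<open>T\<close> can never turn around, hence winds around the whole cycle.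
\<close>

lemma sourceless_imp_unicycle:
  assumes T: "T \<subseteq> {1..n}" "T \<noteq> {}"
    and pred: "\<And>v. v \<in> T \<Longrightarrow> A v \<inter> T \<noteq> {}"
    and asym: "\<And>u v. u \<in> T \<Longrightarrow> v \<in> T \<Longrightarrow> u \<in> A v \<Longrightarrow> v \<notin> A u"
  shows "unicycle G"
proof -
  obtain v0 u0 where v0: "v0 \<in> T" and u0: "u0 \<in> A v0" "u0 \<in> T" using T(2) pred by blast
  have v0_eq: "v0 = cyclic_index n (int v0)" using cyclic_index_of_nat v0 T(1) by auto
  obtain d :: int where d: "d = 1 \<or> d = -1" "u0 = cyclic_index n (int v0 + d)"
    using neighbour[of u0 "int v0"] u0(1) v0_eq by auto
  \<comment> \<open>\<open>w\<close> continues in the direction \<open>d\<close> of the first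
    backward step.\<close>
  define w where "w m = cyclic_index n (int v0 + d * int m)" for m
  have w_Suc: "w (Suc m) = cyclic_index n (int v0 + d * int m + d)" for m
    by (simp add: w_def algebra_simps)
  have turn: "u = w (Suc (Suc m)) \<or> u = w m" if "u \<in> A (w (Suc m))" for u m
  proof -
    have "u \<in> A (cyclic_index n (int v0 + d * int (Suc m)))" using that by (simp only: w_def)
    then obtain d' :: int where d': "d' = 1 \<or> d' = -1"
        "u = cyclic_index n (int v0 + d * int (Suc m) + d')"
      by (rule neighbour)
    have "d' = d \<or> d' = -d" using d(1) d'(1) by auto
    then show ?thesis
    proof
      assume "d' = d"
      then show ?thesis using d'(2) by (simp add: w_def algebra_simps)
    next
      assume "d' = -d"
      then show ?thesis using d'(2) by (simp add: w_def algebra_simps)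
    qed
  qed
  \<comment> \<open>Stepping back to \<open>w m\<close> would create an opposite pair in
    \<open>T\<close>, against \<open>asym\<close>.\<close>
  have walk: "w m \<in> T \<and> w (Suc m) \<in> T \<and> w (Suc m) \<in> A (w m)" for m
  proof (induction m)
    case 0
    then show ?case using v0 u0 v0_eq d(2) by (simp add: w_def)
  next
    case (Suc m)
    then obtain u where "u \<in> A (w (Suc m))" "u \<in> T" using pred by blast
    then show ?case using turn[of u m] asym[of "w m" "w (Suc m)"] Suc by auto
  qed
  have w_range: "w ` {..<n} = {1..n}" unfolding w_def by (rule range_cyclic_index[OF n d(1)])
  have w_inj: "inj_on w {..<n}" unfolding w_def by (rule inj_on_cyclic_index[OF n d(1)])
  have w_period: "w (m + n) = w m" for m
    using n by (simp add: w_def cyclic_index_eq_iff cong_iff_dvd_diff algebra_simps)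
  have "w ` {..<n} \<subseteq> T" using walk by (intro image_subsetI) simp
  then have T_eq: "T = {1..n}" using T(1) by (simp add: w_range)
  have "w (Suc 0) \<noteq> w 0" using walk[of 0] A[of "w 0"] T_eq by blast
  then have n2: "2 \<le> n" using w_period[of 0] n by (cases "n = 1") auto
  \<comment> \<open>The list is reversed because \<open>w\<close> follows arcs from head to
    tail.\<close>
  define q where "q m = rev (map (\<lambda>i. (w (Suc i), w i)) [0..<m])" for m
  have set_q: "set (q m) = (\<lambda>i. (w (Suc i), w i)) ` {..<m}" for m by (auto simp: q_def)
  have cas: "pre_digraph.cas G (w m) (q m) (w 0)" for m
    by (induction m) (auto simp: q_def pre_digraph.cas.simps side_info_graph_simps)
  have heads: "map snd (q n) = rev (map w [0..<n])"
    by (simp add: q_def rev_map comp_def)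
  have distinct: "distinct (map (head G) (q n))"
    using w_inj by (simp add: heads head_side_info_graph distinct_map atLeast0LessThan)
  have arcs: "set (q n) = arcs G"
  proof
    show "set (q n) \<subseteq> arcs G" using walk T_eq by (auto simp: set_q side_info_graph_simps)
    show "arcs G \<subseteq> set (q n)"
    proof clarify
      fix u v assume "(u, v) \<in> arcs G"
      then have v: "v \<in> {1..n}" "u \<in> A v" by (auto simp: side_info_graph_simps)
      then obtain m where m: "m < n" "v = w m" using w_range by blast
      \<comment> \<open>\<open>m + n - 1\<close> is the position before \<open>m\<close> modulo
        \<open>n\<close>, valid also for \<open>m = 0\<close>. An arc from there to
        \<open>w m\<close> would oppose an arc of the walk.\<close>
      have per: "w (Suc (m + n - 1)) = w m" "w (Suc (Suc (m + n - 1))) = w (Suc m)"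
        using w_period[of m] w_period[of "Suc m"] n by simp_all
      have "u \<noteq> w (m + n - 1)"
        using asym[of "w (m + n - 1)" "w m"] v m walk[of "m + n - 1"] walk[of m] per(1) by auto
      then have "u = w (Suc m)" using turn[of u "m + n - 1"] v m per by auto
      then show "(u, v) \<in> set (q n)" using m by (auto simp: set_q)
    qed
  qed
  have "w n = w 0" using w_period[of 0] by simp
  then have walk_q: "pre_digraph.awalk G (w 0) (q n) (w 0)"
    using cas[of n] arcs walk T_eq by (auto simp: pre_digraph.awalk_def verts_side_info_graph)
  moreover have "q n \<noteq> []" using n by (simp add: q_def)
  ultimately have cyc: "pre_digraph.cycle G (q n)"
    using distinct by (auto simp: pre_digraph.cycle_def pre_digraph.awalk_def
        pre_digraph.awalk_verts_conv' intro!: exI[of _ "w 0"])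
  have "v \<in> fst ` set (q n)" if "v \<in> {1..n}" for v
  proof -
    obtain m where m: "m < n" "v = w m" using w_range \<open>v \<in> {1..n}\<close> by blast
    define i where "i = (if m = 0 then n - 1 else m - 1)"
    have "v = w (Suc i)" "i < n" using m n \<open>w n = w 0\<close> by (auto simp: i_def)
    then have "v = fst (w (Suc i), w i)" "(w (Suc i), w i) \<in> set (q n)" by (simp_all add: set_q)
    then show ?thesis by (rule image_eqI)
  qed
  moreover have "fst ` set (q n) \<subseteq> {1..n}" using walk T_eq by (auto simp: set_q)
  ultimately have "tail G ` set (q n) = verts G" by (auto simp: side_info_graph_simps)
  then have "hamiltonian_cycle G (q n)"
    using cyc n2 by (simp add: hamiltonian_cycle_def q_def)
  then show ?thesis using arcs by (auto simp: unicycle_def)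
qed

text \<open>Inducing on all of \<open>{1..n}\<close> changes nothing, since all arcs have both ends
  there.\<close>

lemma unicycle_arcs_belong:
  assumes "unicycle G" "e \<in> arcs G"
  shows "belongs_to_unicycle G e"
proof -
  have "induce_subgraph G {1..n} = G"
    using A by (intro pre_digraph.equality) (fastforce simp: side_info_graph_simps)+
  then have "unicycle (induce_subgraph G {1..n}) \<and> e \<in> arcs (induce_subgraph G {1..n})"
    using assms by simp
  moreover have "{1..n} \<subseteq> verts G" by (simp add: verts_side_info_graph)
  ultimately show ?thesis unfolding belongs_to_unicycle_def by blast
qed

text \<open>
  Cutting the cycle of indices at \<open>e\<close> turns the pairs of opposite arcs into a union of paths.
  Sets without such a pair are acyclic in \<^term>\<open>G\<close>, so the colouring of the paths needs no more
  than \<open>r\<close> colours, and its colour classes are cliques that do not use \<open>e\<close>.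
\<close>

lemma ex_index_code_del_arc:
  assumes e: "e \<in> arcs G" "\<not> belongs_to_unicycle G e"
    and code: "index_code G t r \<phi> \<psi>"
  shows "\<exists>\<phi>' \<psi>'. index_code (pre_digraph.del_arc G e) t r \<phi>' \<psi>'"
proof -
  obtain a b where ab: "e = (a, b)" "b \<in> {1..n}" "a \<in> A b"
    using e(1) by (auto simp: arcs_side_info_graph)
  have no_opp: "b \<notin> A a"
    using opposite_arcs_belong_to_unicycle[of a b] A[of b] ab e(2) by auto
  have b_eq: "b = cyclic_index n (int b)" using cyclic_index_of_nat ab(2) by simp
  obtain d :: int where d: "d = 1 \<or> d = -1" "a = cyclic_index n (int b + d)"
    using neighbour[of a "int b"] ab(3) b_eq by auto
  have md: "-d = 1 \<or> -d = -1" using d(1) by auto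
  \<comment> \<open>The numbering starts at the head \<open>b\<close> of \<open>e\<close> and moves
    away from the tail \<open>a\<close>, so the cut falls between \<open>a\<close> and
    \<open>b\<close>.\<close>
  define v where "v k = cyclic_index n (int b + -d * int k)" for k
  have v_range: "v ` {..<n} = {1..n}" unfolding v_def by (rule range_cyclic_index[OF n md])
  have v_inj: "inj_on v {..<n}" unfolding v_def by (rule inj_on_cyclic_index[OF n md])
  define B where "B u w \<longleftrightarrow> u \<in> A w \<and> w \<in> A u" for u w
  have B_sym: "B u w \<longleftrightarrow> B w u" for u w by (auto simp: B_def)
  \<comment> \<open>The wrap-around pair consists of \<open>a\<close> and \<open>b\<close>, which
    \<open>no_opp\<close> excludes; so opposite pairs join only consecutive positions.\<close>
  have B_step: "l = Suc k" if "k < l" "l < n" "B (v k) (v l)" for k l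
  proof -
    have "v l \<in> A (cyclic_index n (int b + -d * int k))" using that(3) by (simp only: B_def v_def)
    then obtain d' :: int where d': "d' = 1 \<or> d' = -1"
        "v l = cyclic_index n (int b + -d * int k + d')"
      by (rule neighbour)
    show ?thesis
    proof (cases "d' = d")
      case False
      then have "d' = -d" using d(1) d'(1) by auto
      then have "v l = v (Suc k)" using d'(2) by (simp add: v_def algebra_simps)
      then show ?thesis using inj_onD[OF v_inj, of l "Suc k"] that by simp
    next
      case True
      show ?thesis
      proof (cases k)
        case 0
        then have "v l = a" "v k = b" using True d' d(2) b_eq by (simp_all add: v_def)
        then show ?thesis using that(3) no_opp by (simp add: B_def)
      next
        case (Suc i)
        then have "v l = v i" using d'(2) True by (simp add: v_def algebra_simps)
        then show ?thesis using inj_onD[OF v_inj, of l i] that Suc by simp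
      qed
    qed
  qed
  define E where "E k \<longleftrightarrow> B (v k) (v (Suc k))" for k
  obtain s I where I: "I \<subseteq> {..<n}" "\<And>k. k \<in> I \<Longrightarrow> Suc k \<in> I \<Longrightarrow> \<not> E k"
    and top: "\<And>k. k < n \<Longrightarrow> s k + t (v k) \<le> sum (\<lambda>k. t (v k)) I"
    and disj: "\<And>k l. k < l \<Longrightarrow> \<not> (l = Suc k \<and> E k) \<Longrightarrow> s k + t (v k) \<le> s l"
    using ex_interval_colouring[of n E "\<lambda>k. t (v k)"] by metis
  have indep: "\<not> B (v k) (v l)" if "k \<in> I" "l \<in> I" "k < l" for k l
    using B_step[of k l] I that unfolding E_def by blast
  have "sum t (v ` I) \<le> r"
  proof (rule index_code_acyclic_bound[OF code])
    show "finite (v ` I)" using I(1) finite_subset by blast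
    show "v ` I \<subseteq> verts G" using I(1) v_range by (auto simp: verts_side_info_graph)
    fix T assume T: "T \<subseteq> v ` I" "T \<noteq> {}"
    have TV: "T \<subseteq> {1..n}" using T(1) I(1) v_range by blast
    have asym: "x \<notin> A y" if "y \<in> T" "x \<in> T" "y \<in> A x" for x y
    proof
      assume "x \<in> A y"
      then have "B x y" using that by (simp add: B_def)
      obtain k l where kl: "k \<in> I" "l \<in> I" "x = v k" "y = v l" using T(1) \<open>x \<in> T\<close> \<open>y \<in> T\<close> by blast
      have "x \<noteq> y" using A[of x] TV that by blast
      then have "k < l \<or> l < k" using kl nat_neq_iff by blast
      then show False using indep kl \<open>B x y\<close> B_sym by blast
    qed
    \<comment> \<open>A sourceless \<open>T\<close> without opposite pairs would make
      \<open>G\<close> a unicycle containing \<open>e\<close>.\<close>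
    have "\<not> unicycle G" using unicycle_arcs_belong e by blast
    then obtain j where "j \<in> T" "A j \<inter> T = {}"
      using sourceless_imp_unicycle[OF TV T(2) _ asym] by blast
    then show "\<exists>j\<in>T. side_info G j \<inter> T = {}"
      using side_info_side_info_graph TV by blast
  qed
  then have sum_le: "sum (\<lambda>k. t (v k)) I \<le> r"
    using inj_on_subset[OF v_inj I(1)] by (simp add: sum.reindex)
  let ?D = "pre_digraph.del_arc G e"
  have vD: "verts ?D = {1..n}" by (simp add: pre_digraph.del_arc_simps verts_side_info_graph)
  define pos where "pos = inv_into {..<n} v"
  have pos: "pos j < n" "v (pos j) = j" if "j \<in> {1..n}" for j
    using inv_into_into[of j v "{..<n}"] f_inv_into_f[of j v "{..<n}"] that v_range
    by (auto simp: pos_def)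
  show ?thesis
  proof (rule ex_index_code_intervals[where s = "\<lambda>j. s (pos j)"])
    show "finite (verts ?D)" by (simp add: vD)
    show "s (pos j) + t j \<le> r" if "j \<in> verts ?D" for j
      using top[of "pos j"] pos[of j] that sum_le by (simp add: vD)
    fix i j
    assume i: "i \<in> verts ?D" and j: "j \<in> verts ?D" and "i \<noteq> j"
      and meet: "{s (pos i)..<s (pos i) + t i} \<inter> {s (pos j)..<s (pos j) + t j} \<noteq> {}"
    have ij: "i \<in> {1..n}" "j \<in> {1..n}" using i j by (auto simp: vD)
    have pos_ne: "pos i \<noteq> pos j" using pos[OF ij(1)] pos[OF ij(2)] \<open>i \<noteq> j\<close> by metis
    have "B i j"
    proof (cases "pos i < pos j")
      case True
      have "\<not> s (pos i) + t i \<le> s (pos j)" using meet by auto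
      then have "pos j = Suc (pos i)" "E (pos i)"
        using disj[OF True] pos(2)[OF ij(1)] by auto
      then show ?thesis using pos(2)[OF ij(1)] pos(2)[OF ij(2)] by (simp add: E_def)
    next
      case False
      then have lt: "pos j < pos i" using pos_ne by simp
      have "\<not> s (pos j) + t j \<le> s (pos i)" using meet by auto
      then have "pos i = Suc (pos j)" "E (pos j)"
        using disj[OF lt] pos(2)[OF ij(2)] by auto
      then have "B j i" using pos(2)[OF ij(1)] pos(2)[OF ij(2)] by (simp add: E_def)
      then show ?thesis using B_sym by blast
    qed
    \<comment> \<open>The pair is opposite while \<open>e\<close> has no reverse arc, so
      \<open>(i, j)\<close> is not \<open>e\<close> and survives the deletion.\<close>
    then show "i \<in> side_info ?D j"
      using no_opp ab(1) by (auto simp: side_info_del_arc[OF ij(2)] B_def)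
  qed
qed

text \<open>Every code survives the deletion of \<open>e\<close> with the same lengths, so the
  region does not shrink.\<close>

lemma critical_imp_belongs_to_unicycle:
  assumes "critical_arc G e"
  shows "belongs_to_unicycle G e"
proof (rule ccontr)
  assume not: "\<not> belongs_to_unicycle G e"
  have "e \<in> arcs G" using assms by (simp add: critical_arc_def)
  then have "capacity_region G \<subseteq> capacity_region (pre_digraph.del_arc G e)"
    using ex_index_code_del_arc[OF _ not]
    by (intro capacity_region_mono) (auto simp: pre_digraph.del_arc_simps)
  then show False using assms by (auto simp: critical_arc_def)
qed

end

theorem proposition8:
  fixes n :: nat and A :: "nat \<Rightarrow> nat set" and e :: "nat \<times> nat"
  assumes "n \<ge> 1"
    and "\<And>j. j \<in> {1..n} \<Longrightarrow> A j \<subseteq> {1..n} - {j}"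
    and "\<And>j. j \<in> {1..n} \<Longrightarrow>
           A j \<subseteq> {cyclic_index n (int j - 1), cyclic_index n (int j + 1)}"
    and "e \<in> arcs (side_info_graph n A)"
  shows "critical_arc (side_info_graph n A) e \<longleftrightarrow> belongs_to_unicycle (side_info_graph n A) e"
proof -
  interpret cyclic_side_info n A by (rule cyclic_side_info.intro) (use assms(1-3) in blast)+
  show ?thesis
    by (rule iffI[OF critical_imp_belongs_to_unicycle belongs_to_unicycle_imp_critical])
qed

end
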